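(* Let $\Theta\subseteq\mathbb{R}$, let $\{p(\cdot|\theta),\ \theta\in\Theta\}$ be a family of probability density functions of $\boldsymbol{X}=(X_1,\ldots,X_n)$, and let $\rho(\varepsilon)=\varepsilon^2$. Then $$R_n(\Theta)\ \ge\ \sup_{\theta_0,\Delta,q,r,w}\Delta^2\cdot\Big\{\max_{u\in[0,1]}[(1-u)q+ur]\cdot P_{\mathrm{e}}\Big(\tfrac{(1-u)q}{(1-u)q+ur},\theta_0-\Delta,\theta_0\Big)+\max_{v\in[0,1]}[vr+(1-v)w]\cdot P_{\mathrm{e}}\Big(\tfrac{vr}{vr+(1-v)w},\theta_0,\theta_0+\Delta\Big)\Big\},$$ where the supremum is over all $\theta_0,\Delta$ with $\theta_0-\Delta,\theta_0,\theta_0+\Delta\in\Theta$ and all non-negative $q,r,w$ with $q+r+w=1$, and where a product whose bracketed factor $[\,\cdot\,]$ is zero is interpreted as $0$.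
   Context: The alphabet $\mathcal{X}\subseteq\mathbb{R}$ is the set of values of each $X_i$, and each $p(\cdot|\theta)$ is regarded as a probability density on $\mathbb{R}^n$ vanishing outside $\mathcal{X}^n$ (in the discrete case densities are probability mass functions and integrals are sums). $\mathbf{E}_\theta$ denotes expectation when $\boldsymbol{X}\sim p(\cdot|\theta)$. An estimator is a (measurable) function $g_n:\mathcal{X}^n\to\Theta$. The minimax risk is $$R_n(\Theta)=\inf_{g_n}\sup_{\theta\in\Theta}\mathbf{E}_\theta\{\rho(g_n[\boldsymbol{X}]-\theta)\},$$ the infimum being over all estimators. For $q\in[0,1]$ and $\theta_0,\theta_1\in\Theta$, $$P_{\mathrm{e}}(q,\theta_0,\theta_1)=\int_{\mathbb{R}^n}\min\{q\,p(\boldsymbol{x}|\theta_0),(1-q)\,p(\boldsymbol{x}|\theta_1)\}\,d\boldsymbol{x}.$$ *)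

theory Defs
  imports "HOL-Probability.Probability"
begin

definition alphabet_power :: "real set \<Rightarrow> (real ^ 'n) set" where
  "alphabet_power X = {x. \<forall>i. x $ i \<in> X}"

definition is_density :: "(real ^ 'n) measure \<Rightarrow> real set \<Rightarrow> (real ^ 'n \<Rightarrow> real) \<Rightarrow> bool" where
  "is_density \<mu> X f \<longleftrightarrow>
     f \<in> borel_measurable \<mu> \<and> (\<forall>x. 0 \<le> f x) \<and> (\<integral>\<^sup>+ x. ennreal (f x) \<partial>\<mu>) = 1 \<and>
     (\<forall>x. x \<notin> alphabet_power X \<longrightarrow> f x = 0)"

(* The values of an estimator outside the n-th power of the alphabet are arbitrary;
   every density vanishes there, so they do not affect the risk. *)
definition estimators :: "real set \<Rightarrow> real set \<Rightarrow> (real ^ 'n \<Rightarrow> real) set" where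
  "estimators X \<Theta> = restrict_space borel (alphabet_power X) \<rightarrow>\<^sub>M restrict_space borel \<Theta>"

(* The expectation is a nonnegative Lebesgue integral, so it may be infinite.
   The loss function rho is meant to be nonnegative: ennreal truncates negative values to 0. *)
definition risk ::
  "(real ^ 'n) measure \<Rightarrow> (real \<Rightarrow> real ^ 'n \<Rightarrow> real) \<Rightarrow> (real \<Rightarrow> real) \<Rightarrow> (real ^ 'n \<Rightarrow> real) \<Rightarrow> real \<Rightarrow> ennreal"
  where
  "risk \<mu> p \<rho> g \<theta> = (\<integral>\<^sup>+ x. ennreal (\<rho> (g x - \<theta>)) \<partial>density \<mu> (\<lambda>x. ennreal (p \<theta> x)))"

definition minimax_risk ::
  "(real ^ 'n) measure \<Rightarrow> real set \<Rightarrow> real set \<Rightarrow> (real \<Rightarrow> real ^ 'n \<Rightarrow> real) \<Rightarrow> (real \<Rightarrow> real) \<Rightarrow> ennreal"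
  where
  "minimax_risk \<mu> X \<Theta> p \<rho> = (INF g\<in>estimators X \<Theta>. SUP \<theta>\<in>\<Theta>. risk \<mu> p \<rho> g \<theta>)"

definition P_e ::
  "(real ^ 'n) measure \<Rightarrow> (real \<Rightarrow> real ^ 'n \<Rightarrow> real) \<Rightarrow> real \<Rightarrow> real \<Rightarrow> real \<Rightarrow> real"
  where
  "P_e \<mu> p q \<theta>\<^sub>0 \<theta>\<^sub>1 = (\<integral>x. min (q * p \<theta>\<^sub>0 x) ((1 - q) * p \<theta>\<^sub>1 x) \<partial>\<mu>)"

(* An attained maximum, not merely a supremum: the value is unspecified if there is no
   greatest element. *)
definition maximum_on :: "'a set \<Rightarrow> ('a \<Rightarrow> real) \<Rightarrow> real" where
  "maximum_on S f = (GREATEST y. y \<in> f ` S)"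

end

theory Submission
  imports Defs
begin

text \<open>
  Fix an estimate at offset \<open>a\<close> from the middle parameter, and let \<open>A\<close>, \<open>B\<close>, \<open>C\<close> be the prior-weighted
  densities of the three parameters at an observation. The posterior-weighted loss
  \<open>A (a + \<Delta>)\<^sup>2 + B a\<^sup>2 + C (a - \<Delta>)\<^sup>2\<close> dominates
  \<open>\<Delta>\<^sup>2 (min ((1 - u) A) (u B) + min (v B) ((1 - v) C))\<close> pointwise: the outer parameter lying on the far
  side of the estimate already costs \<open>A \<Delta>\<^sup>2\<close> or \<open>C \<Delta>\<^sup>2\<close>, and the two other terms are
  handled by convexity of the square. Integrating bounds the Bayes risk, hence the minimax risk, for
  every \<open>u\<close> and \<open>v\<close>; dominated convergence and compactness show that both maxima are attained.
\<close>

text \<open>Convexity of the square applied to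
  \<open>s + t = v * (s / v) + (1 - v) * (t / (1 - v))\<close> gives
  \<open>(s + t)\<^sup>2 \<le> s\<^sup>2 / v + t\<^sup>2 / (1 - v)\<close>; then multiply by
  \<open>m\<close>. Only upper bounds on \<open>m\<close> are asked for, so a minimum with its
  arguments in either order fits.\<close>

lemma two_point_square_loss:
  fixes m v B C s t :: real
  assumes "0 \<le> v" "v \<le> 1" "0 \<le> B" "0 \<le> C" "m \<le> v * B" "m \<le> (1 - v) * C"
  shows "m * (s + t)\<^sup>2 \<le> B * s\<^sup>2 + C * t\<^sup>2"
proof (cases "v = 0 \<or> v = 1")
  case True
  then have "m \<le> 0" using assms by auto
  then have "m * (s + t)\<^sup>2 \<le> 0" by (simp add: mult_nonpos_nonneg)
  also have "0 \<le> B * s\<^sup>2 + C * t\<^sup>2" using assms by simp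
  finally show ?thesis .
next
  case False
  with assms have v: "0 < v" "0 < 1 - v" by auto
  \<comment> \<open>This square is exactly the right side minus the left side of
    \<open>conv\<close>, the convexity inequality cleared of denominators.\<close>
  have "0 \<le> ((1 - v) * s - v * t)\<^sup>2" by simp
  then have conv: "v * (1 - v) * (s + t)\<^sup>2 \<le> (1 - v) * s\<^sup>2 + v * t\<^sup>2"
    by (simp add: power2_eq_square algebra_simps)
  show ?thesis
  proof (cases "0 \<le> m")
    case True
    have "v * (1 - v) * (m * (s + t)\<^sup>2) = m * (v * (1 - v) * (s + t)\<^sup>2)" by simp
    also have "\<dots> \<le> m * ((1 - v) * s\<^sup>2 + v * t\<^sup>2)" using conv True by (rule mult_left_mono)
    also have "\<dots> = m * ((1 - v) * s\<^sup>2) + m * (v * t\<^sup>2)" by (simp add: algebra_simps)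
    also have "\<dots> \<le> v * B * ((1 - v) * s\<^sup>2) + (1 - v) * C * (v * t\<^sup>2)"
      using assms v by (intro add_mono mult_right_mono) auto
    also have "\<dots> = v * (1 - v) * (B * s\<^sup>2 + C * t\<^sup>2)" by (simp add: algebra_simps)
    finally show ?thesis using v by simp
  next
    case False
    then have "m * (s + t)\<^sup>2 \<le> 0" by (simp add: mult_nonpos_nonneg)
    also have "0 \<le> B * s\<^sup>2 + C * t\<^sup>2" using assms by simp
    finally show ?thesis .
  qed
qed

lemma three_point_square_loss:
  fixes A B C a \<Delta> u v :: real
  assumes "0 \<le> A" "0 \<le> B" "0 \<le> C" "u \<in> {0..1}" "v \<in> {0..1}"
  shows "\<Delta>\<^sup>2 * (min ((1 - u) * A) (u * B) + min (v * B) ((1 - v) * C))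
    \<le> A * (a + \<Delta>)\<^sup>2 + B * a\<^sup>2 + C * (a - \<Delta>)\<^sup>2"
    (is "\<Delta>\<^sup>2 * (?m + ?m') \<le> _")
\<comment> \<open>The errors against the outer parameters are \<open>a + \<Delta>\<close> and
  \<open>a - \<Delta>\<close>. The sign of the product, not of \<open>a\<close>, tells which of them
  is at least \<open>\<bar>\<Delta>\<bar>\<close> in absolute value, since \<open>\<Delta>\<close>
  may be negative.\<close>
proof (cases "0 \<le> a * \<Delta>")
  case True
  have "?m \<le> (1 - u) * A" by simp
  also have "\<dots> \<le> A" using assms by (simp add: mult_left_le_one_le)
  finally have "?m * \<Delta>\<^sup>2 \<le> A * \<Delta>\<^sup>2" by (rule mult_right_mono) simp
  also have "\<dots> \<le> A * (a + \<Delta>)\<^sup>2"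
    using assms True by (intro mult_left_mono) (simp_all add: power2_sum mult.assoc)
  finally have "?m * \<Delta>\<^sup>2 \<le> A * (a + \<Delta>)\<^sup>2" .
  \<comment> \<open>The two errors are signed so that they add up to
    \<open>\<Delta>\<close>.\<close>
  moreover have "?m' * (a + (\<Delta> - a))\<^sup>2 \<le> B * a\<^sup>2 + C * (\<Delta> - a)\<^sup>2"
    using assms by (intro two_point_square_loss[of v]) auto
  ultimately show ?thesis by (simp add: algebra_simps power2_commute[of a])
next
  case False
  have "?m' \<le> (1 - v) * C" by simp
  also have "\<dots> \<le> C" using assms by (simp add: mult_left_le_one_le)
  finally have "?m' * \<Delta>\<^sup>2 \<le> C * \<Delta>\<^sup>2" by (rule mult_right_mono) simp
  also have "\<dots> \<le> C * (a - \<Delta>)\<^sup>2"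
  proof (rule mult_left_mono)
    show "\<Delta>\<^sup>2 \<le> (a - \<Delta>)\<^sup>2"
      using False zero_le_power2[of a] unfolding power2_diff mult.assoc by linarith
  qed fact
  finally have "?m' * \<Delta>\<^sup>2 \<le> C * (a - \<Delta>)\<^sup>2" .
  moreover have "?m * (- a + (a + \<Delta>))\<^sup>2 \<le> B * (- a)\<^sup>2 + A * (a + \<Delta>)\<^sup>2"
    using assms by (intro two_point_square_loss[of u]) auto
  ultimately show ?thesis by (simp add: algebra_simps)
qed

text \<open>Compactness supplies the greatest value, without which \<open>GREATEST\<close> would be
  unspecified.\<close>

lemma maximum_on_attained:
  fixes f :: "'a::topological_space \<Rightarrow> real"
  assumes "compact S" "S \<noteq> {}" "continuous_on S f"
  obtains x where "x \<in> S" "maximum_on S f = f x"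
proof -
  obtain x where x: "x \<in> S" "\<And>y. y \<in> S \<Longrightarrow> f y \<le> f x"
    using continuous_attains_sup[OF assms] by blast
  then have "maximum_on S f = f x"
    unfolding maximum_on_def by (intro Greatest_equality) auto
  with x show thesis using that by blast
qed

text \<open>Dominated convergence along sequences: continuous coefficients are bounded on the
  compact set by some \<open>K\<close> and \<open>L\<close>, which yields the integrable majorant
  \<open>K * \<bar>f x\<bar> + L * \<bar>g x\<bar>\<close>.\<close>

lemma continuous_on_integral_min:
  fixes f g :: "'b \<Rightarrow> real" and \<alpha> \<beta> :: "'a::{first_countable_topology, t2_space} \<Rightarrow> real"
  assumes "compact S" and \<alpha>: "continuous_on S \<alpha>" and \<beta>: "continuous_on S \<beta>"
    and f: "integrable M f" and g: "integrable M g"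
  shows "continuous_on S (\<lambda>u. \<integral>x. min (\<alpha> u * f x) (\<beta> u * g x) \<partial>M)"
proof (rule continuous_on_sequentiallyI)
  fix U a assume U: "\<forall>n. U n \<in> S" "a \<in> S" "U \<longlonglongrightarrow> a"
  have "bounded (\<alpha> ` S)" "bounded (\<beta> ` S)"
    using assms by (auto intro!: compact_imp_bounded compact_continuous_image)
  then obtain K L where K: "\<And>u. u \<in> S \<Longrightarrow> \<bar>\<alpha> u\<bar> \<le> K" and L: "\<And>u. u \<in> S \<Longrightarrow> \<bar>\<beta> u\<bar> \<le> L"
    by (auto simp: bounded_iff)
  have lim: "(\<lambda>n. \<alpha> (U n)) \<longlonglongrightarrow> \<alpha> a" "(\<lambda>n. \<beta> (U n)) \<longlonglongrightarrow> \<beta> a"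
    using U \<alpha> \<beta> by (auto intro!: continuous_on_tendsto_compose[of S])
  show "(\<lambda>n. \<integral>x. min (\<alpha> (U n) * f x) (\<beta> (U n) * g x) \<partial>M)
      \<longlonglongrightarrow> (\<integral>x. min (\<alpha> a * f x) (\<beta> a * g x) \<partial>M)"
  proof (rule integral_dominated_convergence)
    show "integrable M (\<lambda>x. K * \<bar>f x\<bar> + L * \<bar>g x\<bar>)" using f g by simp
    show "AE x in M. (\<lambda>n. min (\<alpha> (U n) * f x) (\<beta> (U n) * g x)) \<longlonglongrightarrow> min (\<alpha> a * f x) (\<beta> a * g x)"
      by (intro AE_I2 tendsto_intros lim)
    show "AE x in M. norm (min (\<alpha> (U n) * f x) (\<beta> (U n) * g x)) \<le> K * \<bar>f x\<bar> + L * \<bar>g x\<bar>" for n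
    proof (intro AE_I2)
      fix x
      have "\<bar>\<alpha> (U n) * f x\<bar> \<le> K * \<bar>f x\<bar>" "\<bar>\<beta> (U n) * g x\<bar> \<le> L * \<bar>g x\<bar>"
        using U K L by (auto simp: abs_mult intro!: mult_right_mono)
      then show "norm (min (\<alpha> (U n) * f x) (\<beta> (U n) * g x)) \<le> K * \<bar>f x\<bar> + L * \<bar>g x\<bar>"
        unfolding real_norm_def by linarith
    qed
  qed (use f g in simp_all)
qed

text \<open>Multiplying by the bracket undoes the normalization of the weights. This removes the
  quotient, which need not be continuous where the bracket vanishes; there both sides are 0.\<close>

lemma weighted_P_e:
  assumes "0 \<le> a" "0 \<le> b"
  shows "(a + b) * P_e \<mu> p (a / (a + b)) \<theta>\<^sub>0 \<theta>\<^sub>1 = (\<integral>x. min (a * p \<theta>\<^sub>0 x) (b * p \<theta>\<^sub>1 x) \<partial>\<mu>)"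
proof (cases "a + b = 0")
  case True
  then have "a = 0" "b = 0" using assms by auto
  then show ?thesis by simp
next
  case False
  with assms have pos: "0 < a + b" by simp
  have "(a + b) * min (a / (a + b) * s) ((1 - a / (a + b)) * t) = min (a * s) (b * t)" for s t
  proof -
    have "(a + b) * (a / (a + b) * s) = a * s" "(a + b) * ((1 - a / (a + b)) * t) = b * t"
      using pos by (simp_all add: field_simps)
    then show ?thesis by (simp only: min_mult_distrib_left assms add_nonneg_nonneg if_True)
  qed
  then show ?thesis unfolding P_e_def by (simp flip: integral_mult_right_zero)
qed

text \<open>Continuity is proved for the integral form and carried over to the product with
  \<open>P_e\<close>, so a maximizer exists. The maximum is returned free of division, ready for the
  Bayes risk bound.\<close>

lemma maximum_on_weighted_P_e:
  fixes \<alpha> \<beta> :: "'a::{first_countable_topology, t2_space} \<Rightarrow> real"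
  assumes "compact S" "S \<noteq> {}" "continuous_on S \<alpha>" "continuous_on S \<beta>"
    and "\<And>u. u \<in> S \<Longrightarrow> 0 \<le> \<alpha> u" "\<And>u. u \<in> S \<Longrightarrow> 0 \<le> \<beta> u"
    and "integrable \<mu> (p \<theta>\<^sub>0)" "integrable \<mu> (p \<theta>\<^sub>1)"
  obtains u where "u \<in> S"
    "maximum_on S (\<lambda>u. (\<alpha> u + \<beta> u) * P_e \<mu> p (\<alpha> u / (\<alpha> u + \<beta> u)) \<theta>\<^sub>0 \<theta>\<^sub>1)
      = (\<integral>x. min (\<alpha> u * p \<theta>\<^sub>0 x) (\<beta> u * p \<theta>\<^sub>1 x) \<partial>\<mu>)"
proof -
  have "continuous_on S (\<lambda>u. \<integral>x. min (\<alpha> u * p \<theta>\<^sub>0 x) (\<beta> u * p \<theta>\<^sub>1 x) \<partial>\<mu>)"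
    using assms by (intro continuous_on_integral_min)
  then have "continuous_on S (\<lambda>u. (\<alpha> u + \<beta> u) * P_e \<mu> p (\<alpha> u / (\<alpha> u + \<beta> u)) \<theta>\<^sub>0 \<theta>\<^sub>1)"
    by (rule continuous_on_eq) (simp add: assms weighted_P_e)
  from maximum_on_attained[OF assms(1,2) this] show thesis
    using that assms(5,6) by (auto simp: weighted_P_e)
qed

lemma is_density_integrable:
  assumes "is_density \<mu> X f"
  shows "integrable \<mu> f"
  using assms by (intro integrableI_nonneg) (auto simp: is_density_def)

text \<open>The alphabet need not be a Borel set, so an estimator need not extend to a Borel
  function; it is Borel measurable on the support of the density, which is enough.\<close>

lemma estimator_loss_measurable:
  fixes \<mu> :: "(real ^ 'n) measure"
  assumes "\<mu> = lborel \<or> \<mu> = count_space UNIV" and f: "is_density \<mu> X f" and g: "g \<in> estimators X \<Theta>"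
  shows "(\<lambda>x. f x * (g x - \<theta>)\<^sup>2) \<in> borel_measurable \<mu>"
  using assms(1)
proof
  assume \<mu>: "\<mu> = lborel"
  define S where "S = {x. f x \<noteq> 0}"
  have fm [measurable]: "f \<in> borel_measurable borel" using f \<mu> by (simp add: is_density_def)
  have S [measurable]: "S \<in> sets borel" unfolding S_def by measurable
  have SX: "S \<subseteq> alphabet_power X" using f by (auto simp: S_def is_density_def)
  have "g \<in> borel_measurable (restrict_space borel (alphabet_power X))"
    using g by (auto simp: estimators_def measurable_restrict_space2_iff)
  then have "g \<in> borel_measurable (restrict_space (restrict_space borel (alphabet_power X)) S)"
    by (rule measurable_restrict_space1)
  also have "\<dots> = borel_measurable (restrict_space borel S)"
    using SX by (intro measurable_cong_sets) (simp_all add: sets_restrict_restrict_space Int_absorb1)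
  \<comment> \<open>Extending \<open>g\<close> by 0 off \<open>S\<close> leaves the product with
    \<open>f\<close> unchanged, because \<open>f\<close> vanishes there.\<close>
  finally have "(\<lambda>x. if x \<in> S then g x else 0) \<in> borel_measurable borel"
    by (subst measurable_If_restrict_space_iff) auto
  then have "(\<lambda>x. f x * ((if x \<in> S then g x else 0) - \<theta>)\<^sup>2) \<in> borel_measurable borel"
    by measurable
  also have "(\<lambda>x. f x * ((if x \<in> S then g x else 0) - \<theta>)\<^sup>2) = (\<lambda>x. f x * (g x - \<theta>)\<^sup>2)"
    by (auto simp: S_def)
  finally show ?thesis using \<mu> by simp
\<comment> \<open>For the counting measure every function is measurable.\<close>
qed simp

lemma risk_square_loss:
  fixes \<mu> :: "(real ^ 'n) measure"
  assumes \<mu>: "\<mu> = lborel \<or> \<mu> = count_space UNIV" and f: "is_density \<mu> X (p \<theta>)"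
    and g: "g \<in> estimators X \<Theta>"
  shows "risk \<mu> p (\<lambda>\<epsilon>. \<epsilon>\<^sup>2) g \<theta> = (\<integral>\<^sup>+x. ennreal (p \<theta> x * (g x - \<theta>)\<^sup>2) \<partial>\<mu>)"
proof -
  have [measurable]: "p \<theta> \<in> borel_measurable \<mu>" and nn: "\<And>x. 0 \<le> p \<theta> x"
    using f by (auto simp: is_density_def)
  have loss [measurable]: "(\<lambda>x. p \<theta> x * (g x - \<theta>)\<^sup>2) \<in> borel_measurable \<mu>"
    by (rule estimator_loss_measurable[OF \<mu> f g])
  \<comment> \<open>The loss alone need not be measurable, as \<open>nn_integral_density\<close>
    requires. Dividing the measurable product by the density gives a measurable function that agrees
    with the loss wherever the density is nonzero.\<close>
  let ?h = "\<lambda>x. ennreal (p \<theta> x * (g x - \<theta>)\<^sup>2 / p \<theta> x)"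
  have "AE x in density \<mu> (\<lambda>x. ennreal (p \<theta> x)). ennreal ((g x - \<theta>)\<^sup>2) = ?h x"
    by (subst AE_density) auto
  then have "risk \<mu> p (\<lambda>\<epsilon>. \<epsilon>\<^sup>2) g \<theta> = (\<integral>\<^sup>+x. ?h x \<partial>density \<mu> (\<lambda>x. ennreal (p \<theta> x)))"
    unfolding risk_def by (rule nn_integral_cong_AE)
  also have "\<dots> = (\<integral>\<^sup>+x. ennreal (p \<theta> x) * ?h x \<partial>\<mu>)"
    by (rule nn_integral_density) measurable
  also have "\<dots> = (\<integral>\<^sup>+x. ennreal (p \<theta> x * (g x - \<theta>)\<^sup>2) \<partial>\<mu>)"
    using nn by (intro nn_integral_cong) (auto simp flip: ennreal_mult)
  finally show ?thesis .
qed

text \<open>This is \<open>three_point_square_loss\<close> integrated over the observations, with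
  offset \<open>g x - \<theta>\<^sub>0\<close> and prior-weighted densities as \<open>A\<close>,
  \<open>B\<close>, \<open>C\<close>.\<close>

lemma bayes_risk_ge:
  fixes \<mu> :: "(real ^ 'n) measure"
  assumes \<mu>: "\<mu> = lborel \<or> \<mu> = count_space UNIV" and dens: "\<forall>\<theta>\<in>\<Theta>. is_density \<mu> X (p \<theta>)"
    and g: "g \<in> estimators X \<Theta>"
    and \<theta>: "\<theta>\<^sub>0 - \<Delta> \<in> \<Theta>" "\<theta>\<^sub>0 \<in> \<Theta>" "\<theta>\<^sub>0 + \<Delta> \<in> \<Theta>"
    and prior: "0 \<le> q" "0 \<le> r" "0 \<le> w" and uv: "u \<in> {0..1}" "v \<in> {0..1}"
  shows "ennreal (\<Delta>\<^sup>2 * ((\<integral>x. min ((1 - u) * q * p (\<theta>\<^sub>0 - \<Delta>) x) (u * r * p \<theta>\<^sub>0 x) \<partial>\<mu>)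
      + (\<integral>x. min (v * r * p \<theta>\<^sub>0 x) ((1 - v) * w * p (\<theta>\<^sub>0 + \<Delta>) x) \<partial>\<mu>)))
    \<le> ennreal q * risk \<mu> p (\<lambda>\<epsilon>. \<epsilon>\<^sup>2) g (\<theta>\<^sub>0 - \<Delta>) + ennreal r * risk \<mu> p (\<lambda>\<epsilon>. \<epsilon>\<^sup>2) g \<theta>\<^sub>0
      + ennreal w * risk \<mu> p (\<lambda>\<epsilon>. \<epsilon>\<^sup>2) g (\<theta>\<^sub>0 + \<Delta>)"
proof -
  let ?m = "\<lambda>x. min ((1 - u) * q * p (\<theta>\<^sub>0 - \<Delta>) x) (u * r * p \<theta>\<^sub>0 x)"
  let ?m' = "\<lambda>x. min (v * r * p \<theta>\<^sub>0 x) ((1 - v) * w * p (\<theta>\<^sub>0 + \<Delta>) x)"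
  let ?L = "\<lambda>\<theta> x. p \<theta> x * (g x - \<theta>)\<^sup>2"
  have nn: "0 \<le> p \<theta> x" if "\<theta> \<in> \<Theta>" for \<theta> x
    using dens that by (auto simp: is_density_def)
  have int: "integrable \<mu> (p \<theta>)" if "\<theta> \<in> \<Theta>" for \<theta>
    using dens that is_density_integrable by blast
  have L: "?L \<theta> \<in> borel_measurable \<mu>" if "\<theta> \<in> \<Theta>" for \<theta>
    using dens that \<mu> g by (intro estimator_loss_measurable) auto
  note [measurable] = L[OF \<theta>(1)] L[OF \<theta>(2)] L[OF \<theta>(3)]
  have m: "integrable \<mu> ?m" "integrable \<mu> ?m'"
    using int \<theta> by (auto intro!: integrable_min)
  \<comment> \<open>Nonnegativity allows the passage to the extended integral, needed because the
    risks may be infinite.\<close>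
  have pos: "0 \<le> \<Delta>\<^sup>2 * (?m x + ?m' x)" for x
    using nn[OF \<theta>(1)] nn[OF \<theta>(2)] nn[OF \<theta>(3)] prior uv
    by (intro mult_nonneg_nonneg add_nonneg_nonneg min.boundedI) auto
  have "ennreal (\<Delta>\<^sup>2 * ((\<integral>x. ?m x \<partial>\<mu>) + (\<integral>x. ?m' x \<partial>\<mu>))) = ennreal (\<integral>x. \<Delta>\<^sup>2 * (?m x + ?m' x) \<partial>\<mu>)"
    using m by simp
  also have "\<dots> = (\<integral>\<^sup>+x. ennreal (\<Delta>\<^sup>2 * (?m x + ?m' x)) \<partial>\<mu>)"
    using m pos by (intro nn_integral_eq_integral[symmetric]) auto
  also have "\<dots> \<le> (\<integral>\<^sup>+x. ennreal q * ennreal (?L (\<theta>\<^sub>0 - \<Delta>) x) + ennreal r * ennreal (?L \<theta>\<^sub>0 x)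
      + ennreal w * ennreal (?L (\<theta>\<^sub>0 + \<Delta>) x) \<partial>\<mu>)"
  proof (intro nn_integral_mono)
    fix x
    have "\<Delta>\<^sup>2 * (?m x + ?m' x) \<le> q * ?L (\<theta>\<^sub>0 - \<Delta>) x + r * ?L \<theta>\<^sub>0 x + w * ?L (\<theta>\<^sub>0 + \<Delta>) x"
      using three_point_square_loss[of "q * p (\<theta>\<^sub>0 - \<Delta>) x" "r * p \<theta>\<^sub>0 x" "w * p (\<theta>\<^sub>0 + \<Delta>) x" u v \<Delta> "g x - \<theta>\<^sub>0"]
        prior uv nn \<theta> by (simp add: mult.assoc diff_diff_eq diff_add_eq diff_diff_eq2)
    then show "ennreal (\<Delta>\<^sup>2 * (?m x + ?m' x)) \<le> ennreal q * ennreal (?L (\<theta>\<^sub>0 - \<Delta>) x)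
        + ennreal r * ennreal (?L \<theta>\<^sub>0 x) + ennreal w * ennreal (?L (\<theta>\<^sub>0 + \<Delta>) x)"
      using prior nn \<theta> by (simp add: ennreal_leI flip: ennreal_mult ennreal_plus)
  qed
  also have "\<dots> = ennreal q * (\<integral>\<^sup>+x. ennreal (?L (\<theta>\<^sub>0 - \<Delta>) x) \<partial>\<mu>)
      + ennreal r * (\<integral>\<^sup>+x. ennreal (?L \<theta>\<^sub>0 x) \<partial>\<mu>) + ennreal w * (\<integral>\<^sup>+x. ennreal (?L (\<theta>\<^sub>0 + \<Delta>) x) \<partial>\<mu>)"
    by (simp add: nn_integral_add nn_integral_cmult)
  finally show ?thesis
    using dens \<theta> by (simp add: risk_square_loss[OF \<mu> _ g])
qed

text \<open>Passage from Bayes risk to worst-case risk: each risk is below the supremum, and the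
  prior weights sum to 1.\<close>

lemma bayes_risk_le_SUP:
  fixes R :: "real \<Rightarrow> ennreal"
  assumes "\<theta>\<^sub>0 \<in> \<Theta>" "\<theta>\<^sub>1 \<in> \<Theta>" "\<theta>\<^sub>2 \<in> \<Theta>" "0 \<le> q" "0 \<le> r" "0 \<le> w" "q + r + w = 1"
  shows "ennreal q * R \<theta>\<^sub>0 + ennreal r * R \<theta>\<^sub>1 + ennreal w * R \<theta>\<^sub>2 \<le> (SUP \<theta>\<in>\<Theta>. R \<theta>)"
proof -
  have "ennreal q * R \<theta>\<^sub>0 + ennreal r * R \<theta>\<^sub>1 + ennreal w * R \<theta>\<^sub>2
      \<le> ennreal q * (SUP \<theta>\<in>\<Theta>. R \<theta>) + ennreal r * (SUP \<theta>\<in>\<Theta>. R \<theta>) + ennreal w * (SUP \<theta>\<in>\<Theta>. R \<theta>)"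
    using assms by (intro add_mono mult_left_mono SUP_upper) auto
  also have "\<dots> = ennreal (q + r + w) * (SUP \<theta>\<in>\<Theta>. R \<theta>)"
    using assms(4-6) by (simp add: distrib_right)
  finally show ?thesis using assms by simp
qed

(* The cases of mu are probability density functions and probability mass functions.
   A product whose bracketed factor is 0 is automatically 0, as division by 0 is total. *)
theorem theorem4:
  fixes \<mu> :: "(real ^ 'n) measure"
    and X \<Theta> :: "real set"
    and p :: "real \<Rightarrow> real ^ 'n \<Rightarrow> real"
  assumes "\<mu> = lborel \<or> \<mu> = count_space UNIV"
    and "\<forall>\<theta>\<in>\<Theta>. is_density \<mu> X (p \<theta>)"
  shows "minimax_risk \<mu> X \<Theta> p (\<lambda>\<epsilon>. \<epsilon>\<^sup>2) \<ge>
    (SUP (\<theta>\<^sub>0, \<Delta>, q, r, w) \<in>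
        {(\<theta>\<^sub>0, \<Delta>, q, r, w). \<theta>\<^sub>0 - \<Delta> \<in> \<Theta> \<and> \<theta>\<^sub>0 \<in> \<Theta> \<and> \<theta>\<^sub>0 + \<Delta> \<in> \<Theta> \<and>
           0 \<le> q \<and> 0 \<le> r \<and> 0 \<le> w \<and> q + r + w = 1}.
      ennreal (\<Delta>\<^sup>2 *
        (maximum_on {0..1} (\<lambda>u. ((1 - u) * q + u * r) *
            P_e \<mu> p ((1 - u) * q / ((1 - u) * q + u * r)) (\<theta>\<^sub>0 - \<Delta>) \<theta>\<^sub>0) +
         maximum_on {0..1} (\<lambda>v. (v * r + (1 - v) * w) *
            P_e \<mu> p (v * r / (v * r + (1 - v) * w)) \<theta>\<^sub>0 (\<theta>\<^sub>0 + \<Delta>)))))"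
  unfolding minimax_risk_def
proof (intro SUP_least INF_greatest, clarify)
  fix \<theta>\<^sub>0 \<Delta> q r w :: real and g :: "real ^ 'n \<Rightarrow> real"
  assume \<theta>: "\<theta>\<^sub>0 - \<Delta> \<in> \<Theta>" "\<theta>\<^sub>0 \<in> \<Theta>" "\<theta>\<^sub>0 + \<Delta> \<in> \<Theta>"
    and prior: "0 \<le> q" "0 \<le> r" "0 \<le> w" and sum: "q + r + w = 1"
    and g: "g \<in> estimators X \<Theta>"
  have int: "integrable \<mu> (p \<theta>)" if "\<theta> \<in> \<Theta>" for \<theta>
    using assms(2) that is_density_integrable by blast
  let ?maxu = "maximum_on {0..1} (\<lambda>u. ((1 - u) * q + u * r) *
    P_e \<mu> p ((1 - u) * q / ((1 - u) * q + u * r)) (\<theta>\<^sub>0 - \<Delta>) \<theta>\<^sub>0)"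
  let ?maxv = "maximum_on {0..1} (\<lambda>v. (v * r + (1 - v) * w) *
    P_e \<mu> p (v * r / (v * r + (1 - v) * w)) \<theta>\<^sub>0 (\<theta>\<^sub>0 + \<Delta>))"
  \<comment> \<open>The two maximizers are found independently of each other and of
    \<open>g\<close>. As \<open>bayes_risk_ge\<close> holds for every pair, both can be inserted at
    once.\<close>
  obtain u where u: "u \<in> {0..1}"
    "?maxu = (\<integral>x. min ((1 - u) * q * p (\<theta>\<^sub>0 - \<Delta>) x) (u * r * p \<theta>\<^sub>0 x) \<partial>\<mu>)"
    by (rule maximum_on_weighted_P_e[of "{0..1::real}" "\<lambda>u. (1 - u) * q" "\<lambda>u. u * r" \<mu> p "\<theta>\<^sub>0 - \<Delta>" \<theta>\<^sub>0])
      (use int \<theta> prior in \<open>auto intro!: continuous_intros\<close>)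
  obtain v where v: "v \<in> {0..1}"
    "?maxv = (\<integral>x. min (v * r * p \<theta>\<^sub>0 x) ((1 - v) * w * p (\<theta>\<^sub>0 + \<Delta>) x) \<partial>\<mu>)"
    by (rule maximum_on_weighted_P_e[of "{0..1::real}" "\<lambda>v. v * r" "\<lambda>v. (1 - v) * w" \<mu> p \<theta>\<^sub>0 "\<theta>\<^sub>0 + \<Delta>"])
      (use int \<theta> prior in \<open>auto intro!: continuous_intros\<close>)
  have "ennreal (\<Delta>\<^sup>2 * (?maxu + ?maxv))
      \<le> ennreal q * risk \<mu> p (\<lambda>\<epsilon>. \<epsilon>\<^sup>2) g (\<theta>\<^sub>0 - \<Delta>) + ennreal r * risk \<mu> p (\<lambda>\<epsilon>. \<epsilon>\<^sup>2) g \<theta>\<^sub>0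
        + ennreal w * risk \<mu> p (\<lambda>\<epsilon>. \<epsilon>\<^sup>2) g (\<theta>\<^sub>0 + \<Delta>)"
    unfolding u(2) v(2) by (rule bayes_risk_ge[OF assms g \<theta> prior u(1) v(1)])
  also have "\<dots> \<le> (SUP \<theta>\<in>\<Theta>. risk \<mu> p (\<lambda>\<epsilon>. \<epsilon>\<^sup>2) g \<theta>)"
    using \<theta> prior sum by (rule bayes_risk_le_SUP)
  finally show "ennreal (\<Delta>\<^sup>2 * (?maxu + ?maxv)) \<le> (SUP \<theta>\<in>\<Theta>. risk \<mu> p (\<lambda>\<epsilon>. \<epsilon>\<^sup>2) g \<theta>)" .
qed

end
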